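(* Let $D=(V,A)$ be a digraph with $n=|V|$ vertices. For each permutation $\sigma\in\mathfrak{S}_V$ set \[\varphi(\sigma):=\sum_{\substack{\gamma\text{ a cycle of }\sigma;\\ \gamma\text{ is a }D\text{-cycle}}}\bigl(\ell(\gamma)-1\bigr).\] Then \[U_D=\sum_{\sigma\in\mathfrak{S}_V(D,\overline{D})}(-1)^{\varphi(\sigma)}\,p_{\operatorname{type}\sigma}.\]
   Context: A digraph is a pair $D=(V,A)$ with $V$ a finite set and $A\subseteq V\times V$ (loops allowed). Its complement is $\overline{D}=(V,(V\times V)\setminus A)$. A $V$-listing is a tuple $w=(w_1,\dots,w_n)$ containing each element of $V$ exactly once. For a $V$-listing $w$, $\operatorname{Des}(w,D)=\{i\in[n-1]:(w_i,w_{i+1})\in A\}$. For $I\subseteq[n-1]$, $L_{I,n}=\sum x_{i_1}x_{i_2}\cdots x_{i_n}$, the sum over all positive integers $i_1\le i_2\le\cdots\le i_n$ with $i_p<i_{p+1}$ for each $p\in I$. The Redei--Berge symmetric function is $U_D=\sum_{w}L_{\operatorname{Des}(w,D),n}$, summed over all $V$-listings $w$. Two nonempty tuples are rotation-equivalent if one is a cyclic rotation of the other. For $\sigma\in\mathfrak{S}_V$ (permutations of $V$), the cycles of $\sigma$ are the rotation-equivalence classes of the tuples $(i,\sigma(i),\dots,\sigma^{k-1}(i))$ with $i\in V$ and $k$ the least positive integer with $\sigma^k(i)=i$; the length $\ell(\gamma)$ of a class is the common length of its tuples; the cyclic arc set of the class of $(v_1,\dots,v_k)$ is $\operatorname{CArcs}\gamma=\{(v_1,v_2),\dots,(v_{k-1},v_k),(v_k,v_1)\}$.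 A $D$-cycle is a rotation-equivalence class $\gamma$ of nonempty tuples of distinct elements of $V$ with $\operatorname{CArcs}\gamma\subseteq A$ (similarly for $\overline{D}$-cycles). $\mathfrak{S}_V(D,\overline{D})$ is the set of $\sigma\in\mathfrak{S}_V$ each of whose cycles is a $D$-cycle or a $\overline{D}$-cycle. $\operatorname{type}\sigma$ is the partition whose entries are the lengths of the cycles of $\sigma$. $p_k=x_1^k+x_2^k+\cdots$ and $p_\lambda=p_{\lambda_1}p_{\lambda_2}\cdots p_{\lambda_m}$ for a partition $\lambda=(\lambda_1,\dots,\lambda_m)$. *)

theory Defs
  imports
    "HOL-Library.Multiset"
    "HOL-Combinatorics.Multiset_Permutations"
    "HOL-Combinatorics.Permutations"
    "HOL-Combinatorics.Cycles"
    "Graph_Theory.Pair_Digraph"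
begin

section \<open>Formal power series in the variables \<open>x\<^sub>i\<close>, \<open>i :: nat\<close>\<close>

text \<open>
  A monomial is encoded as the finite multiset of the indices of its variables, a power series
  as its coefficient function. The index \<open>0\<close> exists in the type but is never used below: all
  sums over indices run over the positive integers.
\<close>

typedef 'a mvps = "UNIV :: (nat multiset \<Rightarrow> 'a) set"
  morphisms mcoeff Abs_mvps ..

setup_lifting type_definition_mvps

lemma mvps_eqI: "(\<And>M. mcoeff f M = mcoeff g M) \<Longrightarrow> f = g"
  by (simp add: mcoeff_inject[symmetric] fun_eq_iff)

lemma finite_multiset_splits: "finite {(K, L). K + L = (M :: 'b multiset)}"
proof -
  have fin: "finite {xs. set xs \<subseteq> set_mset M \<and> length xs \<le> size M}"
    by (rule finite_lists_length_le) simp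
  have sub: "K \<in> mset ` {xs. set xs \<subseteq> set_mset M \<and> length xs \<le> size M}" if "K \<subseteq># M" for K
  proof -
    obtain xs where "mset xs = K" using ex_mset by blast
    then show ?thesis
      using set_mset_mono[OF that] size_mset_mono[OF that] by (auto intro!: image_eqI[of _ _ xs])
  qed
  have "{(K, L). K + L = M} \<subseteq>
    mset ` {xs. set xs \<subseteq> set_mset M \<and> length xs \<le> size M} \<times>
    mset ` {xs. set xs \<subseteq> set_mset M \<and> length xs \<le> size M}"
    using sub by (auto simp del: mem_Collect_eq simp: mset_subset_eq_add_left mset_subset_eq_add_right)
  then show ?thesis
    using fin by (meson finite_SigmaI finite_imageI finite_subset)
qed

instantiation mvps :: (comm_ring_1) comm_ring_1
begin

lift_definition zero_mvps :: "'a mvps" is "\<lambda>_. 0" .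
lift_definition one_mvps :: "'a mvps" is "\<lambda>M. if M = {#} then 1 else 0" .
lift_definition plus_mvps :: "'a mvps \<Rightarrow> 'a mvps \<Rightarrow> 'a mvps" is "\<lambda>f g M. f M + g M" .
lift_definition minus_mvps :: "'a mvps \<Rightarrow> 'a mvps \<Rightarrow> 'a mvps" is "\<lambda>f g M. f M - g M" .
lift_definition uminus_mvps :: "'a mvps \<Rightarrow> 'a mvps" is "\<lambda>f M. - f M" .
lift_definition times_mvps :: "'a mvps \<Rightarrow> 'a mvps \<Rightarrow> 'a mvps" is
  "\<lambda>f g M. \<Sum>(K, L)\<in>{(K, L). K + L = M}. f K * g L" .

instance
proof
  fix a b c :: "'a mvps"
  show "a * b * c = a * (b * c)"
  proof (rule mvps_eqI)
    fix M
    define S where "S M = {(K, L). K + L = (M :: nat multiset)}" for M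
    have fin: "finite (S M)" for M
      by (simp add: S_def finite_multiset_splits)
    have S_iff: "(K, L) \<in> S M \<longleftrightarrow> K + L = M" for K L M
      by (simp add: S_def)
    have "mcoeff (a * b * c) M =
        (\<Sum>(N, L)\<in>S M. \<Sum>(K, J)\<in>S N. mcoeff a K * mcoeff b J * mcoeff c L)"
      by (simp add: times_mvps.rep_eq S_def[symmetric] sum_distrib_right case_prod_beta)
    also have "\<dots> = (\<Sum>x\<in>(SIGMA p : S M. S (fst p)).
        mcoeff a (fst (snd x)) * mcoeff b (snd (snd x)) * mcoeff c (snd (fst x)))"
      by (simp add: sum.Sigma fin case_prod_beta)
    also have "\<dots> = (\<Sum>x\<in>(SIGMA p : S M. S (snd p)).
        mcoeff a (fst (fst x)) * (mcoeff b (fst (snd x)) * mcoeff c (snd (snd x))))"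
      by (rule sum.reindex_bij_witness[where
            i = "\<lambda>((K, N), (J, L)). ((K + J, L), (K, J))" and
            j = "\<lambda>((N, L), (K, J)). ((K, J + L), (J, L))"])
         (auto simp: S_iff algebra_simps)
    also have "\<dots> = (\<Sum>(K, N)\<in>S M. \<Sum>(J, L)\<in>S N. mcoeff a K * (mcoeff b J * mcoeff c L))"
      by (simp add: sum.Sigma fin case_prod_beta)
    also have "\<dots> = mcoeff (a * (b * c)) M"
      by (simp add: times_mvps.rep_eq S_def[symmetric] sum_distrib_left case_prod_beta)
    finally show "mcoeff (a * b * c) M = mcoeff (a * (b * c)) M" .
  qed
  show "a * b = b * a"
  proof (rule mvps_eqI)
    fix M
    show "mcoeff (a * b) M = mcoeff (b * a) M"
      unfolding times_mvps.rep_eq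
      by (rule sum.reindex_bij_witness[where i = prod.swap and j = prod.swap])
         (auto simp: algebra_simps)
  qed
  show "1 * a = a"
  proof (rule mvps_eqI)
    fix M
    have "mcoeff (1 * a) M = (\<Sum>(K, L)\<in>{({#}, M)}. mcoeff 1 K * mcoeff a L)"
      unfolding times_mvps.rep_eq
      by (rule sum.mono_neutral_right) (auto simp: finite_multiset_splits one_mvps.rep_eq split: if_splits)
    then show "mcoeff (1 * a) M = mcoeff a M" by (simp add: one_mvps.rep_eq)
  qed
  show "(a + b) * c = a * c + b * c"
    by (rule mvps_eqI)
       (simp add: times_mvps.rep_eq plus_mvps.rep_eq case_prod_beta distrib_right sum.distrib)
  show "(0 :: 'a mvps) \<noteq> 1"
    by transfer (auto simp: fun_eq_iff)
qed (transfer; simp add: fun_eq_iff algebra_simps; fail)+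

end

lift_definition mvar :: "nat \<Rightarrow> 'a :: comm_ring_1 mvps" is "\<lambda>i M. if M = {#i#} then 1 else 0" .

text \<open>
  The sum of a possibly infinite family, taken coefficientwise. It is the intended formal sum
  for summable families, i.e.\ those in which each monomial occurs in only finitely many
  members; this is the case for the families below.
\<close>

definition formal_sum :: "('i \<Rightarrow> 'a :: comm_ring_1 mvps) \<Rightarrow> 'i set \<Rightarrow> 'a mvps" where
  "formal_sum f S = Abs_mvps (\<lambda>M. \<Sum>i | i \<in> S \<and> mcoeff (f i) M \<noteq> 0. mcoeff (f i) M)"

definition power_sum :: "nat \<Rightarrow> int mvps" where
  "power_sum k = formal_sum (\<lambda>i. mvar i ^ k) {i. 0 < i}"

text \<open>Partitions are encoded as multisets of their entries.\<close>

definition power_sum_partition :: "nat multiset \<Rightarrow> int mvps" where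
  "power_sum_partition \<mu> = (\<Prod>k\<in>#\<mu>. power_sum k)"

text \<open>
  The list \<open>is\<close> stands for \<open>(i\<^sub>1, \<dots>, i\<^sub>n)\<close>, so the entry with (1-based) position \<open>p\<close> is \<open>is ! (p - 1)\<close>.
\<close>

definition fundamental_qsym :: "nat set \<Rightarrow> nat \<Rightarrow> int mvps" where
  "fundamental_qsym I n =
    formal_sum (\<lambda>is. \<Prod>i\<leftarrow>is. mvar i)
      {is. length is = n \<and> (\<forall>i\<in>set is. 0 < i) \<and> sorted is \<and> (\<forall>p\<in>I. is ! (p - 1) < is ! p)}"


subsection \<open>Summability of the families used above\<close>

lemma mcoeff_prod_list_mvar:
  "mcoeff (\<Prod>i\<leftarrow>is. mvar i) M = (if M = mset is then 1 else 0 :: 'a :: comm_ring_1)"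
proof (induction "is" arbitrary: M)
  case Nil
  then show ?case by (simp add: one_mvps.rep_eq)
next
  case (Cons i "is")
  have "mcoeff (mvar i * (\<Prod>i\<leftarrow>is. mvar i)) M =
      (\<Sum>(K, L)\<in>{(K, L). K + L = M}. if K = {#i#} \<and> L = mset is then 1 else 0 :: 'a)"
    unfolding times_mvps.rep_eq by (rule sum.cong) (auto simp: Cons.IH mvar.rep_eq)
  also have "\<dots> = (\<Sum>(K, L)\<in>{(K, L). K + L = M} \<inter> {({#i#}, mset is)}. 1)"
    by (rule sum.mono_neutral_cong_right) (auto simp: finite_multiset_splits split: if_splits)
  also have "\<dots> = (if M = mset (i # is) then 1 else 0)"
    by (auto simp: Int_insert_right)
  finally show ?case by simp
qed

lemma fundamental_qsym_summable:
  "finite {is. is \<in> S \<and> mcoeff (\<Prod>i\<leftarrow>is. mvar i :: 'a :: comm_ring_1 mvps) M \<noteq> 0}"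
proof -
  obtain xs where xs: "mset xs = M" using ex_mset by blast
  show ?thesis
    by (rule finite_subset[OF _ mset_eq_finite[of xs]])
       (auto simp: mcoeff_prod_list_mvar xs split: if_splits)
qed

lemma mcoeff_mvar_power:
  "mcoeff (mvar i ^ k) M = (if M = replicate_mset k i then 1 else 0 :: 'a :: comm_ring_1)"
  using mcoeff_prod_list_mvar[of "replicate k i" M] by (simp add: prod_list_replicate)

lemma power_sum_summable:
  assumes "0 < k"
  shows "finite {i. i \<in> S \<and> mcoeff (mvar i ^ k :: 'a :: comm_ring_1 mvps) M \<noteq> 0}"
  by (rule finite_subset[of _ "set_mset M"])
     (use assms in \<open>auto simp: mcoeff_mvar_power split: if_splits\<close>)


section \<open>Digraphs\<close>

definition digraph_complement :: "'a pair_pre_digraph \<Rightarrow> 'a pair_pre_digraph" where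
  "digraph_complement D = \<lparr> pverts = pverts D, parcs = (pverts D \<times> pverts D) - parcs D \<rparr>"

definition Des :: "'a list \<Rightarrow> 'a pair_pre_digraph \<Rightarrow> nat set" where
  "Des w D = {i \<in> {1..length w - 1}. (w ! (i - 1), w ! i) \<in> parcs D}"

text \<open>The \<open>V\<close>-listings are the elements of \<open>permutations_of_set V\<close>.\<close>

definition redei_berge :: "'a pair_pre_digraph \<Rightarrow> int mvps" where
  "redei_berge D =
    (\<Sum>w\<in>permutations_of_set (pverts D). fundamental_qsym (Des w D) (card (pverts D)))"


section \<open>Cycles\<close>

definition rotation_class :: "'a list \<Rightarrow> 'a list set" where
  "rotation_class xs = {rotate k xs | k. True}"

definition cyc_length :: "'a list set \<Rightarrow> nat" where
  "cyc_length \<gamma> = the_elem (length ` \<gamma>)"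

definition cyc_arcs_tuple :: "'a list \<Rightarrow> ('a \<times> 'a) set" where
  "cyc_arcs_tuple xs = set (zip xs (rotate1 xs))"

definition cyc_arcs :: "'a list set \<Rightarrow> ('a \<times> 'a) set" where
  "cyc_arcs \<gamma> = the_elem (cyc_arcs_tuple ` \<gamma>)"

lemma cyc_length_rotation_class: "cyc_length (rotation_class xs) = length xs"
proof -
  have "length ` rotation_class xs = {length xs}"
    unfolding rotation_class_def by (auto simp: image_iff) (metis length_rotate)
  then show ?thesis by (simp add: cyc_length_def)
qed

lemma cyc_arcs_rotation_class: "cyc_arcs (rotation_class xs) = cyc_arcs_tuple xs"
proof -
  have 1: "cyc_arcs_tuple (rotate1 ys) = cyc_arcs_tuple ys" for ys :: "'a list"
  proof -
    have "zip (rotate1 ys) (rotate1 (rotate1 ys)) = rotate1 (zip ys (rotate1 ys))"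
    proof (rule nth_equalityI)
      fix i assume "i < length (zip (rotate1 ys) (rotate1 (rotate1 ys)))"
      then have "i < length ys" "Suc i mod length ys < length ys"
        by (auto intro: mod_less_divisor)
      then show "zip (rotate1 ys) (rotate1 (rotate1 ys)) ! i = rotate1 (zip ys (rotate1 ys)) ! i"
        by (simp add: nth_rotate1)
    qed simp
    then show ?thesis by (simp add: cyc_arcs_tuple_def)
  qed
  have "cyc_arcs_tuple (rotate k xs) = cyc_arcs_tuple xs" for k
    by (induction k) (simp_all add: 1)
  then have "cyc_arcs_tuple ` rotation_class xs = {cyc_arcs_tuple xs}"
    by (auto simp: rotation_class_def image_iff)
  then show ?thesis by (simp add: cyc_arcs_def)
qed

text \<open>\<open>support \<sigma> i\<close> is the tuple \<open>(i, \<sigma> i, \<dots>, \<sigma>\<^sup>k\<^sup>-\<^sup>1 i)\<close> with \<open>k > 0\<close> least such that \<open>\<sigma>\<^sup>k i = i\<close>.\<close>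

definition perm_cycles :: "'a set \<Rightarrow> ('a \<Rightarrow> 'a) \<Rightarrow> 'a list set set" where
  "perm_cycles V \<sigma> = {rotation_class (support \<sigma> i) | i. i \<in> V}"

definition perm_type :: "'a set \<Rightarrow> ('a \<Rightarrow> 'a) \<Rightarrow> nat multiset" where
  "perm_type V \<sigma> = {#cyc_length \<gamma>. \<gamma> \<in># mset_set (perm_cycles V \<sigma>)#}"

definition digraph_cycles :: "'a pair_pre_digraph \<Rightarrow> 'a list set set" where
  "digraph_cycles D =
    {rotation_class v | v. v \<noteq> [] \<and> distinct v \<and> set v \<subseteq> pverts D \<and>
       cyc_arcs (rotation_class v) \<subseteq> parcs D}"

definition digraph_perms :: "'a pair_pre_digraph \<Rightarrow> ('a \<Rightarrow> 'a) set" where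
  "digraph_perms D =
    {\<sigma>. \<sigma> permutes pverts D \<and>
       (\<forall>\<gamma>\<in>perm_cycles (pverts D) \<sigma>.
          \<gamma> \<in> digraph_cycles D \<or> \<gamma> \<in> digraph_cycles (digraph_complement D))}"

definition phi :: "'a pair_pre_digraph \<Rightarrow> ('a \<Rightarrow> 'a) \<Rightarrow> nat" where
  "phi D \<sigma> = (\<Sum>\<gamma> | \<gamma> \<in> perm_cycles (pverts D) \<sigma> \<and> \<gamma> \<in> digraph_cycles D. cyc_length \<gamma> - 1)"

end

theory Submission
  imports Defs "HOL-Combinatorics.Orbits"
begin

text \<open>
  For arbitrary arc weights \<open>a\<close> on a finite set \<open>V\<close>, summing over \<open>V\<close>-listings \<open>w\<close> and over
  permutations \<open>\<sigma>\<close> of \<open>V\<close>,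
  \[ \sum_w \prod_i (1 + a(w_i, w_{i+1}))
     = \sum_\sigma \prod_{\gamma} \Bigl(\prod_{x \in \gamma} (1 + a(x, \sigma x)) - \prod_{x \in \gamma} a(x, \sigma x)\Bigr), \]
  where \<open>\<gamma>\<close> runs over the cycles of \<open>\<sigma>\<close>. Both sides are affine in each \<open>a(u, v)\<close> with \<open>u \<noteq> v\<close>, and the
  coefficient of \<open>a(u, v)\<close> is the same expression on \<open>V - {v}\<close>, with \<open>u\<close> inheriting the arcs that
  leave \<open>v\<close>; so deletion and contraction reduce to weights that vanish off the diagonal, where both
  sides equal \<open>n!\<close>.

  A monomial of either side of the theorem comes from colourings \<open>f\<close> of \<open>V\<close> by positive integers.
  For fixed \<open>f\<close> let \<open>a(x, y) = 0\<close> if \<open>y\<close> may follow \<open>x\<close>, that is if \<open>f x < f y\<close>, or \<open>f x = f y\<close> and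
  \<open>(x, y)\<close> is not an arc, and \<open>a(x, y) = -1\<close> otherwise. The left-hand side then counts the listings that contribute
  the monomial of \<open>f\<close> to \<open>U\<^sub>D\<close>. On the right-hand side, a cycle on which \<open>f\<close> is not constant has both
  an ascent and a descent of \<open>f\<close>, so both of its products vanish; a cycle on which \<open>f\<close> is constant
  contributes \<open>(-1)\<^sup>\<ell>\<^sup>-\<^sup>1\<close>, \<open>1\<close> or \<open>0\<close> according to whether it is a cycle of \<open>D\<close>, of the complement, or
  of neither.
\<close>

section \<open>Listings and permutations with weighted arcs\<close>

fun path_weight :: "('a \<Rightarrow> 'a \<Rightarrow> 'b :: comm_ring_1) \<Rightarrow> 'a list \<Rightarrow> 'b" where
  "path_weight a (x # y # xs) = (1 + a x y) * path_weight a (y # xs)"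
| "path_weight a xs = 1"

text \<open>The cut vertex \<open>u\<close> is kept in both pieces, so each step of the list lies in
  exactly one of them.\<close>

lemma path_weight_append:
  "path_weight a (xs @ u # ys) = path_weight a (xs @ [u]) * path_weight a (u # ys)"
  by (induction xs rule: induct_list012) (auto simp: mult.assoc)

lemma path_weight_cong:
  assumes "\<And>xs x y ys. w = xs @ x # y # ys \<Longrightarrow> a x y = b x y"
  shows "path_weight a w = path_weight b w"
  using assms
proof (induction w rule: induct_list012)
  case (3 x y zs)
  have "a x' y' = b x' y'" if "y # zs = xs @ x' # y' # ys" for xs x' y' ys
    using "3.prems"[of "x # xs" x' y' ys] that by simp
  then have "path_weight a (y # zs) = path_weight b (y # zs)"
    by (rule "3.IH"(2))
  moreover have "a x y = b x y"
    using "3.prems"[of "[]" x y zs] by simp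
  ultimately show ?case by simp
qed simp_all

text \<open>The step from \<open>u\<close> to \<open>v\<close> contributes \<open>1 + a u v\<close>.
  The summand 1 is what deletion leaves of it. In the other summand \<open>v\<close> is removed from
  the list, and \<open>u\<close> must then pay for the step that left \<open>v\<close>, hence the
  row \<open>a v\<close> at \<open>u\<close>. By distinctness the row of \<open>u\<close> is read
  nowhere else.\<close>

lemma path_weight_contract:
  fixes a :: "'a \<Rightarrow> 'a \<Rightarrow> 'b :: comm_ring_1"
  assumes "distinct (xs @ u # v # ys)"
  shows "path_weight a (xs @ u # v # ys) =
    path_weight (a(u := (a u)(v := 0))) (xs @ u # v # ys) +
    a u v * path_weight (a(u := a v)) (xs @ u # ys)"
proof -
  let ?a0 = "a(u := (a u)(v := 0))" and ?a' = "a(u := a v)"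
  have pre: "path_weight b (xs @ [u]) = path_weight a (xs @ [u])"
    if "\<And>x. x \<noteq> u \<Longrightarrow> b x = a x" for b
  proof (rule path_weight_cong)
    fix xs' x y ys' assume eq: "xs @ [u] = xs' @ x # y # ys'"
    \<comment> \<open>The source of a step is never the last entry of the list, so it lies in
      \<open>xs\<close> and differs from \<open>u\<close>.\<close>
    then have "xs = xs' @ x # butlast (y # ys')"
      by (metis butlast.simps(2) butlast_append butlast_snoc list.distinct(1))
    then have "x \<noteq> u" using assms by auto
    then show "b x y = a x y" using that by simp
  qed
  have suf: "path_weight b (v # ys) = path_weight a (v # ys)"
    if "\<And>x. x \<noteq> u \<Longrightarrow> b x = a x" for b
  proof (rule path_weight_cong)
    fix xs' x y ys' assume "v # ys = xs' @ x # y # ys'"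
    then have "x \<in> set (v # ys)" by simp
    then have "x \<noteq> u" using assms by auto
    then show "b x y = a x y" using that by simp
  qed
  have contr: "path_weight ?a' (u # ys) = path_weight a (v # ys)"
  proof (cases ys)
    case (Cons y zs)
    have "path_weight ?a' ys = path_weight a ys"
    proof (rule path_weight_cong)
      fix xs' x y ys' assume "ys = xs' @ x # y # ys'"
      then have "x \<in> set ys" by simp
      then show "?a' x y = a x y" using assms by auto
    qed
    then show ?thesis using Cons by simp
  qed simp
  show ?thesis
    using assms
    by (simp add: path_weight_append[of _ xs u "v # ys"] path_weight_append[of _ xs u ys]
        pre[of ?a0] pre[of ?a'] suf[of ?a0] contr algebra_simps)
qed

text \<open>Only listings in which \<open>v\<close> comes directly after \<open>u\<close> read the
  entry \<open>a u v\<close>, and erasing \<open>v\<close> maps them bijectively onto the listings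
  of \<open>V - {v}\<close>.\<close>

lemma sum_path_weight_contract:
  fixes a :: "'a \<Rightarrow> 'a \<Rightarrow> 'b :: comm_ring_1"
  assumes "finite V" "u \<in> V" "v \<in> V" "u \<noteq> v"
  shows "(\<Sum>w\<in>permutations_of_set V. path_weight a w) =
    (\<Sum>w\<in>permutations_of_set V. path_weight (a(u := (a u)(v := 0))) w) +
    a u v * (\<Sum>w\<in>permutations_of_set (V - {v}). path_weight (a(u := a v)) w)"
proof -
  let ?a0 = "a(u := (a u)(v := 0))" and ?a' = "a(u := a v)"
  define P where "P = {w \<in> permutations_of_set V. \<exists>xs ys. w = xs @ u # v # ys}"
  \<comment> \<open>Inverse of erasing \<open>v\<close>: it puts \<open>v\<close> back directly
    behind \<open>u\<close>.\<close>
  define ins where "ins = (\<lambda>w. concat (map (\<lambda>x. if x = u then [u, v] else [x]) w))"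
  have ins_id: "ins xs = xs" if "u \<notin> set xs" for xs
    using that by (induction xs) (auto simp: ins_def)
  have ins_split: "ins (xs @ u # ys) = xs @ u # v # ys" if "u \<notin> set xs" "u \<notin> set ys" for xs ys
    using ins_id[OF that(1)] ins_id[OF that(2)] by (simp add: ins_def)
  have del_split: "filter (\<lambda>x. x \<noteq> v) (xs @ u # v # ys) = xs @ u # ys"
    if "v \<notin> set xs" "v \<notin> set ys" for xs ys
  proof -
    have "filter (\<lambda>x. x \<noteq> v) zs = zs" if "v \<notin> set zs" for zs
      using that by (induction zs) auto
    then show ?thesis using that assms(4) by simp
  qed
  have "(\<Sum>w\<in>permutations_of_set V. path_weight a w) -
        (\<Sum>w\<in>permutations_of_set V. path_weight ?a0 w) =
      (\<Sum>w\<in>permutations_of_set V. path_weight a w - path_weight ?a0 w)"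
    by (simp add: sum_subtractf)
  also have "\<dots> = (\<Sum>w\<in>P. path_weight a w - path_weight ?a0 w)"
  proof (rule sum.mono_neutral_right)
    show "\<forall>w\<in>permutations_of_set V - P. path_weight a w - path_weight ?a0 w = 0"
    proof
      fix w assume w: "w \<in> permutations_of_set V - P"
      have "path_weight a w = path_weight ?a0 w"
        by (rule path_weight_cong) (use w in \<open>auto simp: P_def\<close>)
      then show "path_weight a w - path_weight ?a0 w = 0" by simp
    qed
  qed (auto simp: P_def)
  also have "\<dots> = (\<Sum>w\<in>permutations_of_set (V - {v}). a u v * path_weight ?a' w)"
  proof (rule sum.reindex_bij_witness[where j = "filter (\<lambda>x. x \<noteq> v)" and i = ins])
    fix w assume "w \<in> P"
    then obtain xs ys where w: "w = xs @ u # v # ys" and V: "set w = V" and d: "distinct w"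
      by (auto simp: P_def permutations_of_set_def)
    have del: "filter (\<lambda>x. x \<noteq> v) w = xs @ u # ys"
      unfolding w by (rule del_split) (use d w in auto)
    show "ins (filter (\<lambda>x. x \<noteq> v) w) = w"
      unfolding del unfolding w by (rule ins_split) (use d w in auto)
    show "filter (\<lambda>x. x \<noteq> v) w \<in> permutations_of_set (V - {v})"
      using V d by (auto simp: permutations_of_set_def)
    show "a u v * path_weight ?a' (filter (\<lambda>x. x \<noteq> v) w) = path_weight a w - path_weight ?a0 w"
      using path_weight_contract[of xs u v ys a] d unfolding del unfolding w by simp
  next
    fix w assume "w \<in> permutations_of_set (V - {v})"
    then have V: "set w = V - {v}" and d: "distinct w"
      by (auto simp: permutations_of_set_def)
    obtain xs ys where w: "w = xs @ u # ys"
      using V assms by (metis Diff_iff singletonD split_list)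
    have ins: "ins w = xs @ u # v # ys"
      unfolding w by (rule ins_split) (use d w in auto)
    show "filter (\<lambda>x. x \<noteq> v) (ins w) = w"
      unfolding ins unfolding w by (rule del_split) (use V w in auto)
    show "ins w \<in> P"
    proof -
      have "set (ins w) = insert v (set w)" unfolding ins unfolding w by auto
      moreover have "distinct (ins w)" using d V unfolding ins unfolding w by auto
      ultimately show ?thesis
        using V assms(3) ins by (auto simp: P_def permutations_of_set_def)
    qed
  qed
  also have "\<dots> = a u v * (\<Sum>w\<in>permutations_of_set (V - {v}). path_weight ?a' w)"
    by (simp add: sum_distrib_left)
  finally show ?thesis by (simp add: algebra_simps)
qed

text \<open>On a cycle \<open>C\<close> of \<open>\<sigma>\<close> this expands into the sum, over
  all proper subsets of the arcs of the cycle, of the product of their weights. The full arc set is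
  subtracted because the steps of a listing never close up to a cycle.\<close>

definition cycle_weight :: "('a \<Rightarrow> 'a \<Rightarrow> 'b :: comm_ring_1) \<Rightarrow> ('a \<Rightarrow> 'a) \<Rightarrow> 'a set \<Rightarrow> 'b" where
  "cycle_weight a \<sigma> C = (\<Prod>x\<in>C. 1 + a x (\<sigma> x)) - (\<Prod>x\<in>C. a x (\<sigma> x))"

lemma cycle_weight_cong:
  assumes "\<And>x. x \<in> C \<Longrightarrow> a x (\<sigma> x) = b x (\<tau> x)"
  shows "cycle_weight a \<sigma> C = cycle_weight b \<tau> C"
  using assms by (simp add: cycle_weight_def)

section \<open>Permutations: deletion and contraction of an arc\<close>

lemma orbit_eq_orbit:
  assumes "permutation \<sigma>" "y \<in> orbit \<sigma> x"
  shows "orbit \<sigma> y = orbit \<sigma> x"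
  using assms by (meson cyclic_on_orbit' orbit_cyclic_eq3)

text \<open>\<open>\<sigma> \<circ> transpose u v\<close> sends \<open>u\<close> to
  \<open>\<sigma> v\<close> and fixes \<open>v\<close>: the vertex \<open>v\<close> is cut out of
  the cycle of \<open>u\<close>.\<close>

lemma orbit_contract:
  assumes perm: "permutation \<sigma>" and uv: "\<sigma> u = v" "u \<noteq> v"
  shows "orbit (\<sigma> \<circ> transpose u v) u = orbit \<sigma> u - {v}"
proof -
  define \<tau> where "\<tau> = \<sigma> \<circ> transpose u v"
  have inj: "\<sigma> x = \<sigma> y \<longleftrightarrow> x = y" for x y
    using perm by (meson bij_is_inj inj_eq permutation_bijective)
  have \<tau>: "\<tau> x = (if x = u then \<sigma> v else if x = v then v else \<sigma> x)" for x
    using uv by (auto simp: \<tau>_def transpose_def)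
  have "x \<in> orbit \<sigma> u \<and> x \<noteq> v" if "x \<in> orbit \<tau> u" for x
    using that
  proof induction
    case base
    show ?case using uv inj[of u v] by (auto simp: \<tau> intro: orbit.intros)
  next
    case (step y)
    then show ?case using uv inj[of u v] inj[of y u] by (auto simp: \<tau> intro: orbit.intros)
  qed
  moreover have "x \<noteq> v \<longrightarrow> x \<in> orbit \<tau> u" if "x \<in> orbit \<sigma> u" for x
    using that
  proof induction
    case base
    show ?case using uv by simp
  next
    case (step y)
    \<comment> \<open>If \<open>y = u\<close>, the next vertex is the excluded \<open>v\<close>. If
      \<open>y = v\<close>, the induction hypothesis is void, but the next vertex
      \<open>\<sigma> v\<close> is the image of \<open>u\<close> under
      \<open>\<tau>\<close>.\<close>
    consider "y = u" | "y = v" | "y \<noteq> u" "y \<noteq> v" by blast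
    then show ?case
    proof cases
      case 2
      then have "\<sigma> y = \<tau> u" by (simp add: \<tau>)
      then show ?thesis using orbit.base[of \<tau> u] by simp
    next
      case 3
      then have "\<sigma> y = \<tau> y" by (simp add: \<tau>)
      then show ?thesis using orbit.step[of y \<tau> u] step.IH 3 by simp
    qed (use uv in simp)
  qed
  ultimately show ?thesis by (auto simp: \<tau>_def)
qed

text \<open>A cycle other than that of \<open>u\<close> avoids both \<open>u\<close> and
  \<open>v\<close>, where alone the two permutations differ.\<close>

lemma orbits_contract:
  assumes fin: "finite V" and perm: "\<sigma> permutes V" and uv: "\<sigma> u = v" "u \<noteq> v" "u \<in> V"
  shows "orbit (\<sigma> \<circ> transpose u v) ` (V - {v}) =
    insert (orbit \<sigma> u - {v}) (orbit \<sigma> ` V - {orbit \<sigma> u})"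
proof -
  define \<tau> where "\<tau> = \<sigma> \<circ> transpose u v"
  have p: "permutation \<sigma>" using fin perm by (auto simp: permutation_permutes)
  then have p': "permutation \<tau>"
    unfolding \<tau>_def by (intro permutation_compose permutation_swap_id)
  have v: "v \<in> orbit \<sigma> u" using uv orbit.base[of \<sigma> u] by simp
  have self: "x \<in> orbit \<sigma> x" for x using p by (rule permutation_self_in_orbit)
  have in_orb: "orbit \<tau> x = orbit \<sigma> u - {v}" if "x \<in> orbit \<sigma> u" "x \<noteq> v" for x
    using orbit_eq_orbit[OF p', of x u] orbit_contract[OF p uv(1,2)] that by (simp add: \<tau>_def)
  have out_orb: "orbit \<tau> x = orbit \<sigma> x" if "x \<notin> orbit \<sigma> u" for x
  proof (rule orbit_cong[OF self])
    fix s assume "s \<in> orbit \<sigma> x"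
    then have "s \<notin> orbit \<sigma> u"
      using that orbit_eq_orbit[OF p] self by metis
    then have "s \<noteq> u" "s \<noteq> v" using v self by auto
    then show "\<tau> s = \<sigma> s" by (simp add: \<tau>_def)
  qed
  have ne: "orbit \<sigma> x \<noteq> orbit \<sigma> u \<longleftrightarrow> x \<notin> orbit \<sigma> u" for x
    using orbit_eq_orbit[OF p] self by blast
  have "orbit \<tau> ` (V - {v}) = orbit \<tau> ` {x \<in> V. x \<in> orbit \<sigma> u \<and> x \<noteq> v} \<union> orbit \<tau> ` {x \<in> V. x \<notin> orbit \<sigma> u}"
    using v by auto
  also have "orbit \<tau> ` {x \<in> V. x \<in> orbit \<sigma> u \<and> x \<noteq> v} = {orbit \<sigma> u - {v}}"
    using in_orb uv self[of u] by force
  also have "orbit \<tau> ` {x \<in> V. x \<notin> orbit \<sigma> u} = orbit \<sigma> ` {x \<in> V. x \<notin> orbit \<sigma> u}"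
    using out_orb by auto
  also have "\<dots> = orbit \<sigma> ` V - {orbit \<sigma> u}"
    using ne by auto
  finally show ?thesis unfolding \<tau>_def by (simp only: Un_insert_left Un_empty_left)
qed

text \<open>The arc from \<open>u\<close> to \<open>v\<close> lies on the cycle \<open>U\<close> of
  \<open>u\<close> only, so all other factors are common to the three products and the claim reduces
  to the factor of \<open>U\<close>.\<close>

lemma prod_cycle_weight_contract:
  fixes a :: "'a \<Rightarrow> 'a \<Rightarrow> 'b :: comm_ring_1"
  assumes fin: "finite V" and perm: "\<sigma> permutes V" and uv: "\<sigma> u = v" "u \<noteq> v" "u \<in> V"
  shows "(\<Prod>C\<in>orbit \<sigma> ` V. cycle_weight a \<sigma> C) =
    (\<Prod>C\<in>orbit \<sigma> ` V. cycle_weight (a(u := (a u)(v := 0))) \<sigma> C) +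
    a u v * (\<Prod>C\<in>orbit (\<sigma> \<circ> transpose u v) ` (V - {v}).
      cycle_weight (a(u := a v)) (\<sigma> \<circ> transpose u v) C)"
proof -
  let ?a0 = "a(u := (a u)(v := 0))" and ?a' = "a(u := a v)"
  define \<tau> where "\<tau> = \<sigma> \<circ> transpose u v"
  define U where "U = orbit \<sigma> u"
  define R where "R = orbit \<sigma> ` V - {U}"
  have p: "permutation \<sigma>" using fin perm by (auto simp: permutation_permutes)
  have self: "x \<in> orbit \<sigma> x" for x using p by (rule permutation_self_in_orbit)
  have uU: "u \<in> U" and vU: "v \<in> U"
    using self orbit.base[of \<sigma> u] uv by (auto simp: U_def)
  have finU: "finite U" unfolding U_def using self by (rule finite_orbit)
  have finR: "finite R" using fin by (simp add: R_def)
  have orbs: "orbit \<sigma> ` V = insert U R" "U \<notin> R"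
    using uv by (auto simp: R_def U_def)
  have out: "u \<notin> C \<and> v \<notin> C" if C: "C \<in> R" for C
  proof -
    obtain x where "C = orbit \<sigma> x" "C \<noteq> U" using C unfolding R_def by blast
    then show ?thesis
      using orbit_eq_orbit[OF p, of u x] orbit_eq_orbit[OF p, of v x] orbit_eq_orbit[OF p, of v u] vU
      by (auto simp: U_def)
  qed
  \<comment> \<open>The contracted cycle still contains \<open>u\<close>, so it is a new factor and
    does not merge with one from \<open>R\<close>.\<close>
  have "U - {v} \<notin> R"
    using out uU uv by fastforce
  have \<tau>: "\<tau> x = \<sigma> x" if "x \<noteq> u" "x \<noteq> v" for x
    using that by (simp add: \<tau>_def)
  have \<tau>u: "\<tau> u = \<sigma> v" by (simp add: \<tau>_def)
  have R0: "cycle_weight ?a0 \<sigma> C = cycle_weight a \<sigma> C"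
    and R': "cycle_weight ?a' \<tau> C = cycle_weight a \<sigma> C" if "C \<in> R" for C
  proof -
    have "x \<noteq> u" "x \<noteq> v" if "x \<in> C" for x using out[OF \<open>C \<in> R\<close>] that by auto
    then show "cycle_weight ?a0 \<sigma> C = cycle_weight a \<sigma> C" "cycle_weight ?a' \<tau> C = cycle_weight a \<sigma> C"
      by (auto intro!: cycle_weight_cong simp: \<tau>)
  qed
  have Q: "prod g U = g u * g v * prod g (U - {u, v})" for g :: "'a \<Rightarrow> 'b"
  proof -
    have "U = insert u (insert v (U - {u, v}))" using uU vU by auto
    then have "prod g U = prod g (insert u (insert v (U - {u, v})))" by simp
    then show ?thesis using finU uv by (simp add: mult.assoc)
  qed
  have Q': "prod g (U - {v}) = g u * prod g (U - {u, v})" for g :: "'a \<Rightarrow> 'b"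
  proof -
    have "U - {v} = insert u (U - {u, v})" using uU uv by auto
    then have "prod g (U - {v}) = prod g (insert u (U - {u, v}))" by (rule arg_cong)
    also have "\<dots> = g u * prod g (U - {u, v})" using finU by (intro prod.insert) auto
    finally show ?thesis .
  qed
  \<comment> \<open>Put \<open>s = a u v\<close> and \<open>t = a v (\<sigma> v)\<close>, and let
    \<open>P\<close> and \<open>N\<close> be the products of \<open>1 + a\<close> and of
    \<open>a\<close> over the remaining vertices. Then
    \<open>(1 + s) * (1 + t) * P - s * t * N\<close> equals
    \<open>(1 + t) * P + s * ((1 + t) * P - t * N)\<close>.\<close>
  have U: "cycle_weight a \<sigma> U = cycle_weight ?a0 \<sigma> U + a u v * cycle_weight ?a' \<tau> (U - {v})"
  proof -
    have "(\<Prod>x\<in>U - {u, v}. 1 + ?a0 x (\<sigma> x)) = (\<Prod>x\<in>U - {u, v}. 1 + a x (\<sigma> x))"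
      "(\<Prod>x\<in>U - {u, v}. 1 + ?a' x (\<tau> x)) = (\<Prod>x\<in>U - {u, v}. 1 + a x (\<sigma> x))"
      "(\<Prod>x\<in>U - {u, v}. ?a' x (\<tau> x)) = (\<Prod>x\<in>U - {u, v}. a x (\<sigma> x))"
      by (auto intro!: prod.cong simp: \<tau>)
    then show ?thesis
      unfolding cycle_weight_def Q Q' using uv by (simp add: \<tau>u algebra_simps)
  qed
  have "(\<Prod>C\<in>orbit \<tau> ` (V - {v}). cycle_weight ?a' \<tau> C) =
      cycle_weight ?a' \<tau> (U - {v}) * (\<Prod>C\<in>R. cycle_weight a \<sigma> C)"
    using orbits_contract[OF fin perm uv] finR \<open>U - {v} \<notin> R\<close> R'
    by (simp add: \<tau>_def[symmetric] U_def[symmetric] R_def[symmetric])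
  then show ?thesis
    unfolding \<tau>_def[symmetric] orbs(1) using orbs(2) finR R0 U by (simp add: algebra_simps)
qed

text \<open>Permutations with \<open>\<sigma> u \<noteq> v\<close> do not read \<open>a u v\<close>.
  Those with \<open>\<sigma> u = v\<close> correspond to the permutations of \<open>V - {v}\<close>
  by composing with \<open>transpose u v\<close>, which is its own inverse.\<close>

lemma sum_cycle_weight_contract:
  fixes a :: "'a \<Rightarrow> 'a \<Rightarrow> 'b :: comm_ring_1"
  assumes fin: "finite V" and uv: "u \<in> V" "v \<in> V" "u \<noteq> v"
  shows "(\<Sum>\<sigma> | \<sigma> permutes V. \<Prod>C\<in>orbit \<sigma> ` V. cycle_weight a \<sigma> C) =
    (\<Sum>\<sigma> | \<sigma> permutes V. \<Prod>C\<in>orbit \<sigma> ` V. cycle_weight (a(u := (a u)(v := 0))) \<sigma> C) +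
    a u v * (\<Sum>\<sigma> | \<sigma> permutes (V - {v}). \<Prod>C\<in>orbit \<sigma> ` (V - {v}). cycle_weight (a(u := a v)) \<sigma> C)"
proof -
  let ?a0 = "a(u := (a u)(v := 0))" and ?a' = "a(u := a v)"
  let ?W = "\<lambda>b \<sigma>. \<Prod>C\<in>orbit \<sigma> ` V. cycle_weight b \<sigma> C"
  have "(\<Sum>\<sigma> | \<sigma> permutes V. ?W a \<sigma>) - (\<Sum>\<sigma> | \<sigma> permutes V. ?W ?a0 \<sigma>)
      = (\<Sum>\<sigma> | \<sigma> permutes V. ?W a \<sigma> - ?W ?a0 \<sigma>)"
    by (simp add: sum_subtractf)
  also have "\<dots> = (\<Sum>\<sigma> | \<sigma> permutes V \<and> \<sigma> u = v. ?W a \<sigma> - ?W ?a0 \<sigma>)"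
  proof (rule sum.mono_neutral_right)
    show "\<forall>\<sigma>\<in>{\<sigma>. \<sigma> permutes V} - {\<sigma>. \<sigma> permutes V \<and> \<sigma> u = v}. ?W a \<sigma> - ?W ?a0 \<sigma> = 0"
    proof
      fix \<sigma> assume "\<sigma> \<in> {\<sigma>. \<sigma> permutes V} - {\<sigma>. \<sigma> permutes V \<and> \<sigma> u = v}"
      then have "cycle_weight ?a0 \<sigma> C = cycle_weight a \<sigma> C" for C
        by (intro cycle_weight_cong) auto
      then show "?W a \<sigma> - ?W ?a0 \<sigma> = 0" by simp
    qed
  qed (auto simp: fin finite_permutations)
  also have "\<dots> = (\<Sum>\<tau> | \<tau> permutes (V - {v}). a u v * (\<Prod>C\<in>orbit \<tau> ` (V - {v}). cycle_weight ?a' \<tau> C))"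
  proof (rule sum.reindex_bij_witness[where j = "\<lambda>\<sigma>. \<sigma> \<circ> transpose u v" and i = "\<lambda>\<tau>. \<tau> \<circ> transpose u v"])
    fix \<sigma> assume \<sigma>: "\<sigma> \<in> {\<sigma>. \<sigma> permutes V \<and> \<sigma> u = v}"
    show "\<sigma> \<circ> transpose u v \<circ> transpose u v = \<sigma>"
      by (simp add: comp_assoc)
    have "\<sigma> \<circ> transpose u v permutes V"
      using \<sigma> uv by (intro permutes_compose permutes_swap_id) auto
    then show "\<sigma> \<circ> transpose u v \<in> {\<tau>. \<tau> permutes (V - {v})}"
      using \<sigma> by (auto intro: permutes_superset)
    show "a u v * (\<Prod>C\<in>orbit (\<sigma> \<circ> transpose u v) ` (V - {v}). cycle_weight ?a' (\<sigma> \<circ> transpose u v) C)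
        = ?W a \<sigma> - ?W ?a0 \<sigma>"
      using prod_cycle_weight_contract[of V \<sigma> u v a] \<sigma> fin uv by simp
  next
    fix \<tau> assume \<tau>: "\<tau> \<in> {\<tau>. \<tau> permutes (V - {v})}"
    show "\<tau> \<circ> transpose u v \<circ> transpose u v = \<tau>"
      by (simp add: comp_assoc)
    have "\<tau> permutes V" using \<tau> by (auto intro: permutes_subset)
    then show "\<tau> \<circ> transpose u v \<in> {\<sigma>. \<sigma> permutes V \<and> \<sigma> u = v}"
      using \<tau> uv by (auto intro!: permutes_compose permutes_swap_id simp: permutes_not_in)
  qed
  also have "\<dots> = a u v * (\<Sum>\<tau> | \<tau> permutes (V - {v}). \<Prod>C\<in>orbit \<tau> ` (V - {v}). cycle_weight ?a' \<tau> C)"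
    by (simp add: sum_distrib_left)
  finally show ?thesis by (simp add: algebra_simps)
qed

text \<open>A fixed point gives \<open>(1 + a x x) - a x x\<close>. On a longer cycle all weights
  vanish, which leaves \<open>1 - 0\<close>.\<close>

lemma cycle_weight_diagonal:
  assumes perm: "permutation \<sigma>" and "x \<in> V" "\<sigma> permutes V"
    and diag: "\<And>x y. x \<in> V \<Longrightarrow> y \<in> V \<Longrightarrow> x \<noteq> y \<Longrightarrow> a x y = 0"
  shows "cycle_weight a \<sigma> (orbit \<sigma> x) = 1"
proof (cases "\<sigma> x = x")
  case True
  then have "orbit \<sigma> x = {x}" by (simp add: orbit_eq_singleton_iff)
  then show ?thesis by (simp add: cycle_weight_def)
next
  case False
  have self: "x \<in> orbit \<sigma> x" using perm by (rule permutation_self_in_orbit)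
  have sub: "orbit \<sigma> x \<subseteq> V" using assms by (intro permutes_orbit_subset)
  have "a y (\<sigma> y) = 0" if "y \<in> orbit \<sigma> x" for y
  proof -
    have "\<sigma> y \<noteq> y"
      using False self orbit_eq_orbit[OF perm that] orbit_eq_singleton_iff[of \<sigma> y] by auto
    moreover have "\<sigma> y \<in> orbit \<sigma> x" using that by (rule orbit.step)
    ultimately show ?thesis using that sub by (intro diag) auto
  qed
  then show ?thesis
    using self finite_orbit[OF self] by (auto simp: cycle_weight_def prod_zero_iff power_0_left card_eq_0_iff)
qed

text \<open>Double induction. Deletion keeps \<open>V\<close> and lowers the number of nonzero
  off-diagonal weights. Contraction shrinks \<open>V\<close> but may turn zero weights at
  \<open>u\<close> into nonzero ones, so the outer hypothesis must cover all weights.\<close>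

theorem sum_path_weight_eq_sum_cycle_weight:
  fixes a :: "'a \<Rightarrow> 'a \<Rightarrow> 'b :: comm_ring_1"
  assumes "finite V"
  shows "(\<Sum>w\<in>permutations_of_set V. path_weight a w) =
    (\<Sum>\<sigma> | \<sigma> permutes V. \<Prod>C\<in>orbit \<sigma> ` V. cycle_weight a \<sigma> C)"
  using assms
proof (induction "card V" arbitrary: V a rule: less_induct)
  case (less V a)
  note outer = less.hyps and fin = less.prems
  show ?case
  proof (induction "card {(x, y) \<in> V \<times> V. x \<noteq> y \<and> a x y \<noteq> 0}" arbitrary: a rule: less_induct)
    case (less a)
    let ?S = "\<lambda>a. {(x, y) \<in> V \<times> V. x \<noteq> y \<and> a x y \<noteq> (0 :: 'b)}"
    show ?case
    proof (cases "?S a = {}")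
      case True
      then have diag: "a x y = 0" if "x \<in> V" "y \<in> V" "x \<noteq> y" for x y
        using that by blast
      have "path_weight a w = path_weight (\<lambda>_ _. 0) w" if "w \<in> permutations_of_set V" for w
        by (rule path_weight_cong) (use that in \<open>auto simp: permutations_of_set_def intro!: diag\<close>)
      moreover have "path_weight (\<lambda>_ _. 0) w = (1 :: 'b)" for w :: "'a list"
        by (induction w rule: induct_list012) auto
      ultimately have "(\<Sum>w\<in>permutations_of_set V. path_weight a w) = of_nat (fact (card V))"
        using fin by simp
      moreover have "cycle_weight a \<sigma> (orbit \<sigma> x) = 1" if "\<sigma> permutes V" "x \<in> V" for \<sigma> x
        using that fin diag by (intro cycle_weight_diagonal) (auto simp: permutation_permutes)
      then have "(\<Prod>C\<in>orbit \<sigma> ` V. cycle_weight a \<sigma> C) = 1" if "\<sigma> permutes V" for \<sigma>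
        using that by (intro prod.neutral) auto
      ultimately show ?thesis
        using fin by (simp add: card_permutations)
    next
      case False
      then obtain u v where uv: "u \<in> V" "v \<in> V" "u \<noteq> v" and ne: "a u v \<noteq> 0" by auto
      have "?S (a(u := (a u)(v := 0))) \<subset> ?S a"
      proof
        show "?S (a(u := (a u)(v := 0))) \<subseteq> ?S a" by (auto split: if_splits)
        have "(u, v) \<in> ?S a" "(u, v) \<notin> ?S (a(u := (a u)(v := 0)))" using uv ne by auto
        then show "?S (a(u := (a u)(v := 0))) \<noteq> ?S a" by blast
      qed
      moreover have "finite (?S a)"
        by (rule finite_subset[of _ "V \<times> V"]) (use fin in auto)
      ultimately have "card (?S (a(u := (a u)(v := 0)))) < card (?S a)"
        by (intro psubset_card_mono)
      note del = less.hyps[of "a(u := (a u)(v := 0))", OF this]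
      have "card (V - {v}) < card V"
        using fin uv by (intro psubset_card_mono) auto
      note contr = outer[OF this, of "a(u := a v)"]
      show ?thesis
        unfolding sum_path_weight_contract[OF fin uv, of a] sum_cycle_weight_contract[OF fin uv, of a]
        using del contr fin by simp
    qed
  qed
qed


section \<open>Coefficients of products of power sums\<close>

lemma mcoeff_sum: "mcoeff (\<Sum>i\<in>I. f i) M = (\<Sum>i\<in>I. mcoeff (f i) M)"
  by (induction I rule: infinite_finite_induct) (simp_all add: zero_mvps.rep_eq plus_mvps.rep_eq)

lemma mcoeff_neg_one_power_mult: "mcoeff ((-1) ^ k * f) M = (-1) ^ k * mcoeff f M"
  by (cases "even k") (simp_all add: uminus_mvps.rep_eq)

lemma mcoeff_formal_sum:
  "mcoeff (formal_sum f S) M = (\<Sum>i | i \<in> S \<and> mcoeff (f i) M \<noteq> 0. mcoeff (f i) M)"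
  by (simp add: formal_sum_def Abs_mvps_inverse)

lemma mcoeff_fundamental_qsym:
  "mcoeff (fundamental_qsym I n) M =
    int (card {is. length is = n \<and> (\<forall>i\<in>set is. 0 < i) \<and> sorted is \<and>
      (\<forall>p\<in>I. is ! (p - 1) < is ! p) \<and> mset is = M})"
proof -
  have "mcoeff (fundamental_qsym I n) M =
      (\<Sum>is | is \<in> {is. length is = n \<and> (\<forall>i\<in>set is. 0 < i) \<and> sorted is \<and>
        (\<forall>p\<in>I. is ! (p - 1) < is ! p)} \<and> mset is = M. 1)"
    unfolding fundamental_qsym_def mcoeff_formal_sum
    by (rule sum.cong) (auto simp: mcoeff_prod_list_mvar split: if_splits)
  also have "\<dots> = int (card {is. length is = n \<and> (\<forall>i\<in>set is. 0 < i) \<and> sorted is \<and>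
      (\<forall>p\<in>I. is ! (p - 1) < is ! p) \<and> mset is = M})"
    by (simp add: conj_assoc)
  finally show ?thesis .
qed

lemma mcoeff_power_sum:
  "mcoeff (power_sum k) M = int (card {i. 0 < i \<and> M = replicate_mset k i})"
proof -
  have "mcoeff (power_sum k) M = (\<Sum>i | 0 < i \<and> M = replicate_mset k i. 1)"
    unfolding power_sum_def mcoeff_formal_sum
    by (rule sum.cong) (auto simp: mcoeff_mvar_power split: if_splits)
  then show ?thesis by simp
qed

lemma finite_colourings:
  assumes "finite I" "\<And>i. i \<in> I \<Longrightarrow> 0 < l i"
  shows "finite {g \<in> I \<rightarrow>\<^sub>E {0<..}. (\<Sum>i\<in>I. replicate_mset (l i) (g i)) = (M :: nat multiset)}"
proof (rule finite_subset)
  show "finite (I \<rightarrow>\<^sub>E set_mset M)"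
    using assms by (intro finite_PiE) auto
  show "{g \<in> I \<rightarrow>\<^sub>E {0<..}. (\<Sum>i\<in>I. replicate_mset (l i) (g i)) = M} \<subseteq> I \<rightarrow>\<^sub>E set_mset M"
  proof clarify
    fix g assume g: "g \<in> I \<rightarrow>\<^sub>E {0<..}" and M: "M = (\<Sum>i\<in>I. replicate_mset (l i) (g i))"
    have "g i \<in># (\<Sum>i\<in>I. replicate_mset (l i) (g i))" if "i \<in> I" for i
      using that assms by (auto simp: set_mset_sum intro!: bexI[of _ i])
    then show "g \<in> I \<rightarrow>\<^sub>E set_mset (\<Sum>i\<in>I. replicate_mset (l i) (g i))"
      using g by (auto simp: PiE_iff)
  qed
qed

text \<open>Expanding the product means choosing a variable with index \<open>g i\<close> from each
  factor. Extensional functions make each choice count once.\<close>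

lemma mcoeff_prod_power_sum:
  assumes "finite I" "\<And>i. i \<in> I \<Longrightarrow> 0 < l i"
  shows "mcoeff (\<Prod>i\<in>I. power_sum (l i)) M =
    int (card {g \<in> I \<rightarrow>\<^sub>E {0<..}. (\<Sum>i\<in>I. replicate_mset (l i) (g i)) = M})"
  using assms
proof (induction I arbitrary: M rule: finite_induct)
  case empty
  show ?case by (auto simp: one_mvps.rep_eq)
next
  case (insert i I)
  define G where "G J L = {g \<in> J \<rightarrow>\<^sub>E {0<..}. (\<Sum>i\<in>J. replicate_mset (l i) (g i)) = (L :: nat multiset)}" for J L
  define J where "J K = {j. 0 < j \<and> K = replicate_mset (l i) (j :: nat)}" for K
  have finJ: "finite (J K)" for K
    by (rule finite_subset[of _ "set_mset K"]) (use insert.prems in \<open>auto simp: J_def\<close>)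
  have finG: "finite (G I L)" for L
    unfolding G_def using insert by (intro finite_colourings) auto
  have "mcoeff (\<Prod>i\<in>insert i I. power_sum (l i)) M =
      (\<Sum>(K, L)\<in>{(K, L). K + L = M}. int (card (J K \<times> G I L)))"
    using insert by (simp add: times_mvps.rep_eq mcoeff_power_sum G_def J_def card_cartesian_product)
  also have "\<dots> = int (card (SIGMA p : {(K, L). K + L = M}. J (fst p) \<times> G I (snd p)))"
    using finite_multiset_splits[of M] finJ finG by (simp add: case_prod_beta)
  also have "card (SIGMA p : {(K, L). K + L = M}. J (fst p) \<times> G I (snd p)) = card (G (insert i I) M)"
  proof (rule bij_betw_same_card, rule bij_betwI)
    \<comment> \<open>The splitting of \<open>M\<close> is determined by the colouring:
      \<open>K\<close> is the contribution of \<open>i\<close>, and \<open>L\<close> that of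
      \<open>I\<close>.\<close>
    let ?enc = "\<lambda>((K, L), (j, h)). h(i := j)"
    let ?dec = "\<lambda>g. ((replicate_mset (l i) (g i), \<Sum>i\<in>I. replicate_mset (l i) (g i)), (g i, restrict g I))"
    have upd: "(\<Sum>x\<in>I. replicate_mset (l x) (if x = i then j else h x)) = (\<Sum>x\<in>I. replicate_mset (l x) (h x))" for j h
      using insert.hyps by (intro sum.cong) auto
    show "?enc \<in> (SIGMA p : {(K, L). K + L = M}. J (fst p) \<times> G I (snd p)) \<rightarrow> G (insert i I) M"
      using insert.hyps by (auto simp: G_def J_def upd PiE_iff extensional_def)
    show "?dec \<in> G (insert i I) M \<rightarrow> (SIGMA p : {(K, L). K + L = M}. J (fst p) \<times> G I (snd p))"
      using insert.hyps by (auto simp: G_def J_def PiE_iff)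
    show "?dec (?enc x) = x" if "x \<in> (SIGMA p : {(K, L). K + L = M}. J (fst p) \<times> G I (snd p))" for x
      using that insert.hyps by (auto simp: G_def J_def upd PiE_iff extensional_def fun_eq_iff)
    show "?enc (?dec g) = g" if "g \<in> G (insert i I) M" for g
      using that insert.hyps by (auto simp: G_def PiE_iff extensional_def fun_eq_iff)
  qed
  finally show ?case by (simp add: G_def)
qed

section \<open>Colourings that are constant on the cycles of a permutation\<close>

lemma sum_singleton_const: "finite C \<Longrightarrow> (\<Sum>x\<in>C. {#c#}) = replicate_mset (card C) c"
  by (induction C rule: finite_induct) auto

text \<open>A colouring of the orbits is the same as a colouring of \<open>V\<close> invariant under
  \<open>\<sigma>\<close>; an orbit of size \<open>k\<close> uses its colour \<open>k\<close>
  times.\<close>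

lemma card_colourings_orbits:
  assumes fin: "finite V" and perm: "\<sigma> permutes V"
  shows "card {g \<in> orbit \<sigma> ` V \<rightarrow>\<^sub>E {0<..}. (\<Sum>C\<in>orbit \<sigma> ` V. replicate_mset (card C) (g C)) = (M :: nat multiset)} =
    card {f \<in> V \<rightarrow>\<^sub>E {0<..}. image_mset f (mset_set V) = M \<and> (\<forall>x\<in>V. f (\<sigma> x) = f x)}"
    (is "card ?G = card ?F")
proof (rule bij_betw_same_card, rule bij_betwI)
  have p: "permutation \<sigma>" using fin perm by (auto simp: permutation_permutes)
  have self: "x \<in> orbit \<sigma> x" for x using p by (rule permutation_self_in_orbit)
  have sub: "orbit \<sigma> x \<subseteq> V" if "x \<in> V" for x
    using perm that by (rule permutes_orbit_subset)
  have step: "orbit \<sigma> (\<sigma> x) = orbit \<sigma> x" for x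
    using p by (rule permutation_orbit_step)
  have const: "f y = f x" if "\<forall>x\<in>V. f (\<sigma> x) = f x" "x \<in> V" "y \<in> orbit \<sigma> x" for f :: "'a \<Rightarrow> nat" and x y
    using that(3) by induction (use that(1,2) sub[OF that(2)] in auto)
  have some: "(SOME y. y \<in> orbit \<sigma> x) \<in> orbit \<sigma> x" for x
    using self by (rule someI)
  have mset: "image_mset f (mset_set V) = (\<Sum>C\<in>orbit \<sigma> ` V. replicate_mset (card C) (g C))"
    if fg: "\<And>x. x \<in> V \<Longrightarrow> f x = g (orbit \<sigma> x)" for f :: "'a \<Rightarrow> nat" and g
  proof -
    have "image_mset f (mset_set V) = (\<Sum>x\<in>V. {#f x#})"
      by (simp add: sum_unfold_sum_mset)
    also have "\<dots> = (\<Sum>C\<in>orbit \<sigma> ` V. \<Sum>x | x \<in> V \<and> orbit \<sigma> x = C. {#f x#})"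
      using fin by (rule sum.image_gen)
    also have "\<dots> = (\<Sum>C\<in>orbit \<sigma> ` V. replicate_mset (card C) (g C))"
    proof (rule sum.cong[OF refl])
      fix C assume "C \<in> orbit \<sigma> ` V"
      then obtain z where z: "z \<in> V" "C = orbit \<sigma> z" by auto
      \<comment> \<open>The fibre of \<open>orbit \<sigma>\<close> over an orbit is that orbit
        itself.\<close>
      have "x \<in> V \<and> orbit \<sigma> x = C \<longleftrightarrow> x \<in> C" for x
        using z sub[of z] orbit_eq_orbit[OF p, of x z] self[of x] by blast
      then have "{x. x \<in> V \<and> orbit \<sigma> x = C} = C" by blast
      moreover have "(\<Sum>x\<in>C. {#f x#}) = (\<Sum>x\<in>C. {#g C#})"
        using z sub[of z] orbit_eq_orbit[OF p, of _ z] by (intro sum.cong) (auto simp: fg)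
      moreover have "finite C" using z finite_orbit[OF self] by simp
      ultimately show "(\<Sum>x | x \<in> V \<and> orbit \<sigma> x = C. {#f x#}) = replicate_mset (card C) (g C)"
        by (simp add: sum_singleton_const)
    qed
    finally show ?thesis .
  qed
  let ?enc = "\<lambda>g. restrict (\<lambda>x. g (orbit \<sigma> x)) V"
  \<comment> \<open>Any representative of \<open>C\<close> will do, since the colourings in
    \<open>?F\<close> are constant on orbits.\<close>
  let ?dec = "\<lambda>f. restrict (\<lambda>C. f (SOME x. x \<in> C)) (orbit \<sigma> ` V)"
  show "?enc \<in> ?G \<rightarrow> ?F"
  proof
    fix g assume g: "g \<in> ?G"
    have "image_mset (?enc g) (mset_set V) = M"
      using mset[of "?enc g" g] g by simp
    moreover have "\<sigma> x \<in> V \<longleftrightarrow> x \<in> V" for x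
      using perm by (simp add: permutes_in_image)
    ultimately show "?enc g \<in> ?F"
      using g by (auto simp: step PiE_iff)
  qed
  have dec: "?dec f (orbit \<sigma> x) = f x" if "f \<in> ?F" "x \<in> V" for f x
    using const[of f x] some[of x] that by simp
  show "?dec \<in> ?F \<rightarrow> ?G"
  proof
    fix f assume f: "f \<in> ?F"
    have "(\<Sum>C\<in>orbit \<sigma> ` V. replicate_mset (card C) (?dec f C)) = M"
      using mset[of f "?dec f"] dec[OF f] f by simp
    moreover have "?dec f \<in> orbit \<sigma> ` V \<rightarrow>\<^sub>E {0<..}"
    proof
      fix C assume "C \<in> orbit \<sigma> ` V"
      then obtain x where x: "x \<in> V" "C = orbit \<sigma> x" by auto
      have "f x \<in> {0<..}" using f x(1) by (auto simp: PiE_iff)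
      then show "?dec f C \<in> {0<..}" unfolding x(2) dec[OF f x(1)] .
    qed simp
    ultimately show "?dec f \<in> ?G" by blast
  qed
  show "?dec (?enc g) = g" if g: "g \<in> ?G" for g
  proof
    fix C
    show "?dec (?enc g) C = g C"
    proof (cases "C \<in> orbit \<sigma> ` V")
      case True
      then obtain x where x: "x \<in> V" "C = orbit \<sigma> x" by auto
      then have "(SOME y. y \<in> C) \<in> V" "orbit \<sigma> (SOME y. y \<in> C) = C"
        using some[of x] sub[of x] orbit_eq_orbit[OF p some] by auto
      then show ?thesis using True by simp
    next
      case False
      then show ?thesis using g by (auto simp: PiE_iff extensional_def)
    qed
  qed
  show "?enc (?dec f) = f" if f: "f \<in> ?F" for f
  proof
    fix x
    show "?enc (?dec f) x = f x"
      using dec[OF f, of x] f by (cases "x \<in> V") (auto simp: PiE_iff extensional_def)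
  qed
qed


section \<open>Cycles of a permutation as orbits\<close>

lemma set_support_eq_orbit:
  assumes "permutation \<sigma>"
  shows "set (support \<sigma> x) = orbit \<sigma> x"
  unfolding support_set[OF assms] orbit_altdef_permutation[OF assms] by auto

lemma least_power_eq_card_orbit:
  assumes "permutation \<sigma>"
  shows "least_power \<sigma> x = card (orbit \<sigma> x)"
  using distinct_card[OF cycle_of_permutation[OF assms, of x]] set_support_eq_orbit[OF assms, of x]
  by simp

text \<open>The tuple closes up because the least power of \<open>\<sigma>\<close> fixes
  \<open>x\<close>. Consequently the cyclic arcs of the tuple are the pairs
  \<open>(y, \<sigma> y)\<close>.\<close>

lemma rotate1_support:
  assumes p: "permutation \<sigma>"
  shows "rotate1 (support \<sigma> x) = map \<sigma> (support \<sigma> x)"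
proof (rule nth_equalityI)
  fix i assume "i < length (rotate1 (support \<sigma> x))"
  then have i: "i < least_power \<sigma> x" by simp
  then have "Suc i mod least_power \<sigma> x < least_power \<sigma> x" by simp
  then show "rotate1 (support \<sigma> x) ! i = map \<sigma> (support \<sigma> x) ! i"
    using i funpow_mod_eq[OF least_power_of_permutation(1)[OF p, of x], of "Suc i"]
    by (simp add: nth_rotate1)
qed simp

lemma support_step:
  assumes "permutation \<sigma>"
  shows "support \<sigma> (\<sigma> x) = rotate1 (support \<sigma> x)"
  unfolding rotate1_support[OF assms]
  by (simp add: least_power_eq_card_orbit[OF assms] permutation_orbit_step[OF assms] funpow_swap1)

lemma rotation_class_rotate1: "rotation_class (rotate1 xs) = rotation_class xs"
proof -
  have "\<exists>j. rotate k xs = rotate j (rotate1 xs)" for k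
  proof (cases k)
    case 0
    \<comment> \<open>The trivial rotation is rewritten as a full turn, so that one
      \<open>rotate1\<close> can be split off.\<close>
    have "rotate k xs = rotate (length xs) xs" using 0 by simp
    then show ?thesis
      by (cases "length xs") (auto simp: rotate1_rotate_swap)
  next
    case (Suc j)
    then show ?thesis by (auto simp: rotate1_rotate_swap)
  qed
  moreover have "\<exists>j. rotate k (rotate1 xs) = rotate j xs" for k
    by (rule exI[of _ "Suc k"]) (simp add: rotate1_rotate_swap)
  ultimately show ?thesis
    unfolding rotation_class_def by (metis (no_types, lifting))
qed

lemma rotation_class_support_eq:
  assumes "permutation \<sigma>" "y \<in> orbit \<sigma> x"
  shows "rotation_class (support \<sigma> y) = rotation_class (support \<sigma> x)"
  using assms(2)
  by induction (simp_all add: support_step[OF assms(1)] rotation_class_rotate1)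

lemma Union_set_rotation_class: "(\<Union>xs\<in>rotation_class ys. set xs) = set ys"
  unfolding rotation_class_def by auto

text \<open>Translates cycles as rotation classes into cycles as vertex sets. Injectivity holds
  because the tuples started at two points of one orbit are rotations of each other.\<close>

lemma bij_betw_perm_cycles_orbits:
  assumes p: "permutation \<sigma>"
  shows "bij_betw (\<lambda>\<gamma>. \<Union>xs\<in>\<gamma>. set xs) (perm_cycles V \<sigma>) (orbit \<sigma> ` V)"
proof -
  have set: "(\<Union>xs\<in>rotation_class (support \<sigma> x). set xs) = orbit \<sigma> x" for x
    unfolding Union_set_rotation_class set_support_eq_orbit[OF p] ..
  have "inj_on (\<lambda>\<gamma>. \<Union>xs\<in>\<gamma>. set xs) (perm_cycles V \<sigma>)"
  proof (rule inj_onI)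
    fix \<gamma> \<delta> assume "\<gamma> \<in> perm_cycles V \<sigma>" "\<delta> \<in> perm_cycles V \<sigma>"
      and eq: "(\<Union>xs\<in>\<gamma>. set xs) = (\<Union>xs\<in>\<delta>. set xs)"
    then obtain x y where xy: "\<gamma> = rotation_class (support \<sigma> x)" "\<delta> = rotation_class (support \<sigma> y)"
      unfolding perm_cycles_def by blast
    have "orbit \<sigma> x = orbit \<sigma> y" using eq unfolding xy set .
    then have "x \<in> orbit \<sigma> y" using permutation_self_in_orbit[OF p, of x] by simp
    then show "\<gamma> = \<delta>" unfolding xy by (rule rotation_class_support_eq[OF p])
  qed
  moreover have "(\<lambda>\<gamma>. \<Union>xs\<in>\<gamma>. set xs) ` perm_cycles V \<sigma> = orbit \<sigma> ` V"
  proof -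
    have "perm_cycles V \<sigma> = (\<lambda>x. rotation_class (support \<sigma> x)) ` V"
      unfolding perm_cycles_def by auto
    then show ?thesis unfolding image_image by (simp only: image_image set)
  qed
  ultimately show ?thesis by (simp add: bij_betw_def)
qed

lemma cyc_length_perm_cycle:
  assumes "permutation \<sigma>" "\<gamma> \<in> perm_cycles V \<sigma>"
  shows "cyc_length \<gamma> = card (\<Union>xs\<in>\<gamma>. set xs)"
proof -
  obtain x where x: "\<gamma> = rotation_class (support \<sigma> x)"
    using assms(2) unfolding perm_cycles_def by blast
  show ?thesis
    unfolding x cyc_length_rotation_class Union_set_rotation_class set_support_eq_orbit[OF assms(1)]
    by (simp add: least_power_eq_card_orbit[OF assms(1)])
qed

text \<open>The arc set depends only on the class, so whichever tuple witnesses membership in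
  \<open>digraph_cycles D\<close>, the arcs to test are the pairs
  \<open>(y, \<sigma> y)\<close>.\<close>

lemma perm_cycle_in_digraph_cycles:
  assumes fin: "finite (pverts D)" and perm: "\<sigma> permutes pverts D"
    and \<gamma>: "\<gamma> \<in> perm_cycles (pverts D) \<sigma>"
  shows "\<gamma> \<in> digraph_cycles D \<longleftrightarrow> (\<forall>x\<in>(\<Union>xs\<in>\<gamma>. set xs). (x, \<sigma> x) \<in> parcs D)"
proof -
  have p: "permutation \<sigma>" using fin perm by (auto simp: permutation_permutes)
  obtain x where x: "\<gamma> = rotation_class (support \<sigma> x)" "x \<in> pverts D"
    using \<gamma> unfolding perm_cycles_def by blast
  have set: "set (support \<sigma> x) = orbit \<sigma> x" "(\<Union>xs\<in>\<gamma>. set xs) = orbit \<sigma> x"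
    unfolding x Union_set_rotation_class set_support_eq_orbit[OF p] by simp_all
  have "set (zip ys (map \<sigma> ys)) = (\<lambda>y. (y, \<sigma> y)) ` set ys" for ys
    by (induction ys) auto
  then have "cyc_arcs \<gamma> = (\<lambda>y. (y, \<sigma> y)) ` orbit \<sigma> x"
    unfolding x cyc_arcs_rotation_class cyc_arcs_tuple_def rotate1_support[OF p] set(1)[symmetric] .
  then have arcs: "cyc_arcs \<gamma> \<subseteq> parcs D \<longleftrightarrow> (\<forall>y\<in>orbit \<sigma> x. (y, \<sigma> y) \<in> parcs D)"
    by auto
  define s where "s = support \<sigma> x"
  have "distinct s" "s \<noteq> []" "set s \<subseteq> pverts D"
    unfolding s_def
    using cycle_of_permutation[OF p] least_power_of_permutation(2)[OF p]
      permutes_orbit_subset[OF perm x(2)] set(1) by auto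
  moreover have "\<gamma> = rotation_class s" using x(1) unfolding s_def .
  ultimately have "\<gamma> \<in> digraph_cycles D \<longleftrightarrow> cyc_arcs \<gamma> \<subseteq> parcs D"
    unfolding digraph_cycles_def by auto
  then show ?thesis unfolding set(2) arcs .
qed

lemma power_sum_partition_perm_type:
  assumes "permutation \<sigma>"
  shows "power_sum_partition (perm_type V \<sigma>) = (\<Prod>C\<in>orbit \<sigma> ` V. power_sum (card C))"
proof -
  have "power_sum_partition (perm_type V \<sigma>) = (\<Prod>\<gamma>\<in>perm_cycles V \<sigma>. power_sum (cyc_length \<gamma>))"
    by (simp add: power_sum_partition_def perm_type_def image_mset.compositionality comp_def prod_unfold_prod_mset)
  also have "\<dots> = (\<Prod>\<gamma>\<in>perm_cycles V \<sigma>. power_sum (card (\<Union>xs\<in>\<gamma>. set xs)))"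
    using cyc_length_perm_cycle[OF assms] by (intro prod.cong) auto
  also have "\<dots> = (\<Prod>C\<in>orbit \<sigma> ` V. power_sum (card C))"
    by (rule prod.reindex_bij_betw[OF bij_betw_perm_cycles_orbits[OF assms]])
  finally show ?thesis .
qed

lemma mcoeff_power_sum_partition_perm_type:
  assumes fin: "finite V" and perm: "\<sigma> permutes V"
  shows "mcoeff (power_sum_partition (perm_type V \<sigma>)) M =
    int (card {f \<in> V \<rightarrow>\<^sub>E {0<..}. image_mset f (mset_set V) = M \<and> (\<forall>x\<in>V. f (\<sigma> x) = f x)})"
proof -
  have p: "permutation \<sigma>" using fin perm by (auto simp: permutation_permutes)
  have pos: "0 < card C" if C: "C \<in> orbit \<sigma> ` V" for C
    using C permutation_self_in_orbit[OF p] finite_orbit card_gt_0_iff by fastforce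
  show ?thesis
    unfolding power_sum_partition_perm_type[OF p]
    using mcoeff_prod_power_sum[of "orbit \<sigma> ` V" card M] pos fin card_colourings_orbits[OF fin perm, of M]
    by simp
qed


section \<open>Colourings\<close>

definition step_ok :: "('a \<times> 'a) set \<Rightarrow> ('a \<Rightarrow> nat) \<Rightarrow> 'a \<Rightarrow> 'a \<Rightarrow> bool" where
  "step_ok A f x y \<longleftrightarrow> f x < f y \<or> f x = f y \<and> (x, y) \<notin> A"

definition step_weight :: "('a \<times> 'a) set \<Rightarrow> ('a \<Rightarrow> nat) \<Rightarrow> 'a \<Rightarrow> 'a \<Rightarrow> int" where
  "step_weight A f x y = (if step_ok A f x y then 0 else -1)"

lemma path_weight_step_weight:
  "path_weight (step_weight A f) w = (if successively (step_ok A f) w then 1 else 0)"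
  by (induction w rule: induct_list012) (auto simp: step_weight_def)

lemma successively_step_ok_iff:
  "successively (step_ok (parcs D) f) w \<longleftrightarrow>
    sorted (map f w) \<and> (\<forall>p\<in>Des w D. map f w ! (p - 1) < map f w ! p)"
proof -
  have "(\<forall>p\<in>Des w D. map f w ! (p - 1) < map f w ! p) \<longleftrightarrow>
      (\<forall>i. Suc i < length w \<longrightarrow> (w ! i, w ! Suc i) \<in> parcs D \<longrightarrow> f (w ! i) < f (w ! Suc i))"
    (is "?l \<longleftrightarrow> ?r")
  proof
    assume l: ?l
    show ?r
    proof (intro allI impI)
      fix i assume i: "Suc i < length w" "(w ! i, w ! Suc i) \<in> parcs D"
      \<comment> \<open>Descents are numbered from 1, so the step between the list indices
        \<open>i\<close> and \<open>Suc i\<close> has number \<open>Suc i\<close>.\<close>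
      then have "Suc i \<in> Des w D" by (auto simp: Des_def)
      then show "f (w ! i) < f (w ! Suc i)" using l i by fastforce
    qed
  next
    assume r: ?r
    show ?l
    proof
      fix p assume p: "p \<in> Des w D"
      then obtain i where i: "p = Suc i" by (cases p) (auto simp: Des_def)
      show "map f w ! (p - 1) < map f w ! p" using p r unfolding Des_def i by auto
    qed
  qed
  then show ?thesis
    unfolding successively_conv_nth sorted_iff_nth_Suc step_ok_def by (auto simp: order.order_iff_strict)
qed

lemma finite_vertex_colourings:
  assumes "finite V"
  shows "finite {f \<in> V \<rightarrow>\<^sub>E {0<..}. image_mset f (mset_set V) = (M :: nat multiset)}"
proof (rule finite_subset)
  show "{f \<in> V \<rightarrow>\<^sub>E {0<..}. image_mset f (mset_set V) = M} \<subseteq> V \<rightarrow>\<^sub>E set_mset M"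
    using assms by (auto simp: PiE_iff extensional_def)
  show "finite (V \<rightarrow>\<^sub>E set_mset M)" using assms by (intro finite_PiE) auto
qed

text \<open>Reading a colouring along the listing \<open>w\<close> is a bijection between colourings
  of \<open>V\<close> and index sequences of length \<open>card V\<close>. The conditions on the
  sequence say that every step of \<open>w\<close> is admissible.\<close>

lemma mcoeff_fundamental_qsym_Des:
  assumes fin: "finite V" and w: "w \<in> permutations_of_set V"
  shows "mcoeff (fundamental_qsym (Des w D) (card V)) M =
    (\<Sum>f | f \<in> V \<rightarrow>\<^sub>E {0<..} \<and> image_mset f (mset_set V) = M. path_weight (step_weight (parcs D) f) w)"
proof -
  have V: "set w = V" and d: "distinct w"
    using w by (auto simp: permutations_of_set_def)
  have len: "length w = card V" using V d distinct_card by metis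
  have msetw: "mset w = mset_set V" using V d mset_set_set by metis
  let ?F = "{f \<in> V \<rightarrow>\<^sub>E {0<..}. image_mset f (mset_set V) = M}"
  let ?I = "{is. length is = card V \<and> (\<forall>i\<in>set is. 0 < i) \<and> sorted is \<and>
      (\<forall>p\<in>Des w D. is ! (p - 1) < is ! p) \<and> mset is = M}"
  have "(\<Sum>f\<in>?F. path_weight (step_weight (parcs D) f) w) =
      int (card {f \<in> ?F. successively (step_ok (parcs D) f) w})"
    using finite_vertex_colourings[OF fin, of M] by (simp add: path_weight_step_weight sum.If_cases Int_def conj_assoc)
  also have "card {f \<in> ?F. successively (step_ok (parcs D) f) w} = card ?I"
  proof (rule bij_betw_same_card, rule bij_betw_imageI)
    show "inj_on (\<lambda>f. map f w) {f \<in> ?F. successively (step_ok (parcs D) f) w}"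
      by (rule inj_onI) (use V in \<open>auto intro: PiE_ext\<close>)
    show "(\<lambda>f. map f w) ` {f \<in> ?F. successively (step_ok (parcs D) f) w} = ?I"
    proof (intro equalityI subsetI)
      fix "is" assume "is \<in> (\<lambda>f. map f w) ` {f \<in> ?F. successively (step_ok (parcs D) f) w}"
      then obtain f where f: "f \<in> ?F" "successively (step_ok (parcs D) f) w" and "is": "is = map f w"
        by blast
      show "is \<in> ?I"
        using f V len unfolding "is" successively_step_ok_iff by (auto simp: msetw PiE_iff)
    next
      fix "is" assume "is": "is \<in> ?I"
      \<comment> \<open>The colouring that gives the entry of \<open>w\<close> at each position the
        index of \<open>is\<close> at that position.\<close>
      define f where "f = restrict (\<lambda>x. the (map_of (zip w is) x)) V"
      have f: "map f w = is"
      proof (rule nth_equalityI)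
        fix i assume i: "i < length (map f w)"
        then have "w ! i \<in> V" using V by auto
        then show "map f w ! i = is ! i"
          using i "is" len d by (simp add: f_def map_of_zip_nth)
      qed (use "is" len in simp)
      have "f x > 0" if "x \<in> V" for x
      proof -
        have "f x \<in> set is" using that V f by (metis image_eqI set_map)
        then show ?thesis using "is" by blast
      qed
      moreover have "image_mset f (mset_set V) = M"
        using "is" f msetw by (metis (mono_tags, lifting) mem_Collect_eq mset_map)
      moreover have "f \<in> extensional V" by (simp add: f_def)
      ultimately have "f \<in> ?F" by (simp add: PiE_iff)
      moreover have "successively (step_ok (parcs D) f) w"
        using "is" by (simp add: successively_step_ok_iff f)
      ultimately show "is \<in> (\<lambda>f. map f w) ` {f \<in> ?F. successively (step_ok (parcs D) f) w}"
        using f by blast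
    qed
  qed
  finally show ?thesis unfolding mcoeff_fundamental_qsym by simp
qed

lemma cycle_weight_step_weight:
  assumes p: "permutation \<sigma>" and C: "C = orbit \<sigma> x"
  shows "cycle_weight (step_weight A f) \<sigma> C =
    (if \<forall>y\<in>C. f (\<sigma> y) = f y then
       (if \<forall>y\<in>C. (y, \<sigma> y) \<in> A then (-1) ^ (card C - 1) else if \<forall>y\<in>C. (y, \<sigma> y) \<notin> A then 1 else 0)
     else 0)"
proof -
  have self: "x \<in> C" unfolding C using p by (rule permutation_self_in_orbit)
  have fin: "finite C" using finite_orbit[of x \<sigma>] self C by simp
  have inj: "inj_on \<sigma> C"
    using p by (meson bij_is_inj inj_on_subset permutation_bijective subset_UNIV)
  have "\<sigma> ` C \<subseteq> C" unfolding C by (auto intro: orbit.step)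
  then have im: "\<sigma> ` C = C" using inj fin by (simp add: endo_inj_surj)
  show ?thesis
  proof (cases "\<forall>y\<in>C. f (\<sigma> y) = f y")
    case True
    have w: "step_weight A f y (\<sigma> y) = (if (y, \<sigma> y) \<in> A then -1 else 0)" if "y \<in> C" for y
      using True that by (simp add: step_weight_def step_ok_def)
    have 1: "(\<Prod>y\<in>C. 1 + step_weight A f y (\<sigma> y)) = (if \<forall>y\<in>C. (y, \<sigma> y) \<notin> A then 1 else 0)"
      using fin by (auto simp: w intro!: prod.neutral prod_zero)
    have 2: "(\<Prod>y\<in>C. step_weight A f y (\<sigma> y)) = (if \<forall>y\<in>C. (y, \<sigma> y) \<in> A then (-1) ^ card C else 0)"
      using fin by (auto simp: w intro!: prod_zero)
    \<comment> \<open>As \<open>C\<close> is nonempty, the subtraction is not truncated, and the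
      minus sign before the second product turns \<open>(-1) ^ card C\<close> into
      \<open>(-1) ^ (card C - 1)\<close>.\<close>
    have "card C = Suc (card C - 1)" using fin self card_gt_0_iff[of C] by auto
    then have "(-1 :: int) ^ card C = - ((-1) ^ (card C - 1))"
      by (metis power_Suc mult_minus1)
    then show ?thesis using True self unfolding cycle_weight_def 1 2 by auto
  next
    case False
    \<comment> \<open>Since \<open>\<sigma>\<close> permutes \<open>C\<close>, the changes of
      \<open>f\<close> around the cycle add up to zero; if they are not all zero, one is positive
      and one is negative.\<close>
    have sum: "(\<Sum>y\<in>C. f (\<sigma> y)) = (\<Sum>y\<in>C. f y)"
      using sum.reindex[OF inj, of f] by (simp add: im)
    have "\<exists>y\<in>C. f y < f (\<sigma> y)"
    proof (rule ccontr)
      assume "\<not> ?thesis"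
      then have "\<forall>y\<in>C. f (\<sigma> y) \<le> f y" by auto
      moreover from this have "\<exists>y\<in>C. f (\<sigma> y) < f y" using False le_neq_implies_less by metis
      ultimately show False using sum_strict_mono_ex1[OF fin, of "\<lambda>y. f (\<sigma> y)" f] sum by simp
    qed
    then obtain y where "y \<in> C" "f y < f (\<sigma> y)" by blast
    then have "\<exists>y\<in>C. step_weight A f y (\<sigma> y) = 0"
      by (intro bexI[of _ y]) (simp_all add: step_weight_def step_ok_def)
    then have 1: "(\<Prod>y\<in>C. step_weight A f y (\<sigma> y)) = 0"
      using fin by (intro prod_zero)
    have "\<exists>y\<in>C. f (\<sigma> y) < f y"
    proof (rule ccontr)
      assume "\<not> ?thesis"
      then have "\<forall>y\<in>C. f y \<le> f (\<sigma> y)" by auto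
      moreover from this have "\<exists>y\<in>C. f y < f (\<sigma> y)" using False le_neq_implies_less by metis
      ultimately show False using sum_strict_mono_ex1[OF fin, of f "\<lambda>y. f (\<sigma> y)"] sum by simp
    qed
    then obtain y where "y \<in> C" "f (\<sigma> y) < f y" by blast
    then have "\<exists>y\<in>C. 1 + step_weight A f y (\<sigma> y) = 0"
      by (intro bexI[of _ y]) (simp_all add: step_weight_def step_ok_def)
    then have 2: "(\<Prod>y\<in>C. 1 + step_weight A f y (\<sigma> y)) = 0"
      using fin by (intro prod_zero)
    show ?thesis using False unfolding cycle_weight_def 1 2 by auto
  qed
qed

lemma prod_cycle_weight_step_weight:
  assumes fin: "finite (pverts D)" and perm: "\<sigma> permutes pverts D"
  shows "(\<Prod>C\<in>orbit \<sigma> ` pverts D. cycle_weight (step_weight (parcs D) f) \<sigma> C) =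
    (if \<sigma> \<in> digraph_perms D \<and> (\<forall>x\<in>pverts D. f (\<sigma> x) = f x) then (-1) ^ phi D \<sigma> else 0)"
proof -
  let ?V = "pverts D" and ?\<Gamma> = "perm_cycles (pverts D) \<sigma>" and ?W = "cycle_weight (step_weight (parcs D) f) \<sigma>"
  let ?set = "\<lambda>\<gamma>. \<Union>xs\<in>\<gamma>. set xs"
  have p: "permutation \<sigma>" using fin perm by (auto simp: permutation_permutes)
  note bij = bij_betw_perm_cycles_orbits[OF p, of ?V]
  have fin\<Gamma>: "finite ?\<Gamma>"
    using bij fin bij_betw_finite by blast
  have UN: "(\<Union>\<gamma>\<in>?\<Gamma>. ?set \<gamma>) = ?V"
  proof -
    have "(\<Union>\<gamma>\<in>?\<Gamma>. ?set \<gamma>) = \<Union>(orbit \<sigma> ` ?V)"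
      using bij_betw_imp_surj_on[OF bij] by simp
    also have "\<dots> = ?V"
      using permutation_self_in_orbit[OF p] permutes_orbit_subset[OF perm] by fast
    finally show ?thesis .
  qed
  have D: "\<gamma> \<in> digraph_cycles D \<longleftrightarrow> (\<forall>x\<in>?set \<gamma>. (x, \<sigma> x) \<in> parcs D)" if "\<gamma> \<in> ?\<Gamma>" for \<gamma>
    using fin perm that by (rule perm_cycle_in_digraph_cycles)
  have D': "\<gamma> \<in> digraph_cycles (digraph_complement D) \<longleftrightarrow> (\<forall>x\<in>?set \<gamma>. (x, \<sigma> x) \<notin> parcs D)"
    if \<gamma>: "\<gamma> \<in> ?\<Gamma>" for \<gamma>
  proof -
    have "?set \<gamma> \<subseteq> ?V" using UN \<gamma> by blast
    \<comment> \<open>Within \<open>V\<close>, being an arc of the complement is the same as not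
      being an arc of \<open>D\<close>.\<close>
    then have "\<forall>x\<in>?set \<gamma>. x \<in> ?V \<and> \<sigma> x \<in> ?V" using permutes_in_image[OF perm] by blast
    then show ?thesis
      using perm_cycle_in_digraph_cycles[of "digraph_complement D" \<sigma> \<gamma>] fin perm \<gamma>
      by (auto simp: digraph_complement_def)
  qed
  have W: "?W (?set \<gamma>) =
      (if \<forall>y\<in>?set \<gamma>. f (\<sigma> y) = f y then
        (if \<gamma> \<in> digraph_cycles D then (-1) ^ (cyc_length \<gamma> - 1)
         else if \<gamma> \<in> digraph_cycles (digraph_complement D) then 1 else 0) else 0)"
    if \<gamma>: "\<gamma> \<in> ?\<Gamma>" for \<gamma>
  proof -
    obtain x where x: "?set \<gamma> = orbit \<sigma> x" using bij_betwE[OF bij] \<gamma> by blast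
    show ?thesis
      unfolding D[OF \<gamma>] D'[OF \<gamma>] cyc_length_perm_cycle[OF p \<gamma>] by (rule cycle_weight_step_weight[OF p x])
  qed
  have "(\<Prod>C\<in>orbit \<sigma> ` ?V. ?W C) = (\<Prod>\<gamma>\<in>?\<Gamma>. ?W (?set \<gamma>))"
    by (rule prod.reindex_bij_betw[OF bij, symmetric])
  also have "\<dots> = (if \<sigma> \<in> digraph_perms D \<and> (\<forall>x\<in>?V. f (\<sigma> x) = f x) then (-1) ^ phi D \<sigma> else 0)"
  proof (cases "\<sigma> \<in> digraph_perms D \<and> (\<forall>x\<in>?V. f (\<sigma> x) = f x)")
    case True
    have "?W (?set \<gamma>) = (if \<gamma> \<in> digraph_cycles D then (-1) ^ (cyc_length \<gamma> - 1) else 1)" if \<gamma>: "\<gamma> \<in> ?\<Gamma>" for \<gamma>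
    proof -
      have "\<forall>y\<in>?set \<gamma>. f (\<sigma> y) = f y" using True UN \<gamma> by blast
      moreover have "\<gamma> \<in> digraph_cycles D \<or> \<gamma> \<in> digraph_cycles (digraph_complement D)"
        using True \<gamma> by (auto simp: digraph_perms_def)
      ultimately show ?thesis unfolding W[OF \<gamma>] by auto
    qed
    then have "(\<Prod>\<gamma>\<in>?\<Gamma>. ?W (?set \<gamma>)) =
        (\<Prod>\<gamma>\<in>?\<Gamma>. if \<gamma> \<in> digraph_cycles D then (-1) ^ (cyc_length \<gamma> - 1) else 1)"
      by (intro prod.cong) auto
    also have "\<dots> = (\<Prod>\<gamma> | \<gamma> \<in> ?\<Gamma> \<and> \<gamma> \<in> digraph_cycles D. (-1) ^ (cyc_length \<gamma> - 1))"
      using fin\<Gamma> by (rule prod.inter_filter[symmetric])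
    also have "\<dots> = (-1) ^ phi D \<sigma>"
      \<comment> \<open>\<open>power_sum\<close> is here the library rule that turns a power with a
        sum as exponent into a product, not the symmetric function.\<close>
      by (simp add: phi_def power_sum)
    finally show ?thesis using True by simp
  next
    case False
    have "\<exists>\<gamma>\<in>?\<Gamma>. ?W (?set \<gamma>) = 0"
    proof (cases "\<sigma> \<in> digraph_perms D")
      case True
      then obtain x where x: "x \<in> ?V" "f (\<sigma> x) \<noteq> f x" using False by blast
      then obtain \<gamma> where \<gamma>: "\<gamma> \<in> ?\<Gamma>" "x \<in> ?set \<gamma>" using UN by blast
      then have "?W (?set \<gamma>) = 0" unfolding W[OF \<gamma>(1)] using x(2) by auto
      then show ?thesis using \<gamma> by blast
    next
      case nD: False
      then obtain \<gamma> where \<gamma>: "\<gamma> \<in> ?\<Gamma>" "\<gamma> \<notin> digraph_cycles D" "\<gamma> \<notin> digraph_cycles (digraph_complement D)"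
        using perm by (auto simp: digraph_perms_def)
      then have "?W (?set \<gamma>) = 0" unfolding W[OF \<gamma>(1)] by auto
      then show ?thesis using \<gamma> by blast
    qed
    then have "(\<Prod>\<gamma>\<in>?\<Gamma>. ?W (?set \<gamma>)) = 0" using fin\<Gamma> by (intro prod_zero)
    then show ?thesis using False by simp
  qed
  finally show ?thesis .
qed

section \<open>Comparison of the two sides, coefficient by coefficient\<close>

theorem theorem1p31:
  fixes D :: "'a pair_pre_digraph"
  assumes "pair_fin_digraph D"
  shows "redei_berge D =
    (\<Sum>\<sigma>\<in>digraph_perms D. (-1) ^ phi D \<sigma> * power_sum_partition (perm_type (pverts D) \<sigma>))"
proof (rule mvps_eqI)
  fix M :: "nat multiset"
  let ?V = "pverts D"
  have fin: "finite ?V"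
    using assms by (rule pair_fin_digraph.pair_finite_verts)
  \<comment> \<open>One finite set of colourings serves for all listings and all permutations, so
    the sums can be interchanged, the weighted identity applied for each fixed \<open>f\<close>, and
    the sums interchanged back.\<close>
  let ?F = "{f \<in> ?V \<rightarrow>\<^sub>E {0<..}. image_mset f (mset_set ?V) = M}"
  have finF: "finite ?F" using fin by (rule finite_vertex_colourings)
  have perms: "digraph_perms D \<subseteq> {\<sigma>. \<sigma> permutes ?V}" by (auto simp: digraph_perms_def)
  have "mcoeff (redei_berge D) M =
      (\<Sum>w\<in>permutations_of_set ?V. \<Sum>f\<in>?F. path_weight (step_weight (parcs D) f) w)"
    unfolding redei_berge_def mcoeff_sum using mcoeff_fundamental_qsym_Des[OF fin]
    by (intro sum.cong) auto
  also have "\<dots> = (\<Sum>f\<in>?F. \<Sum>w\<in>permutations_of_set ?V. path_weight (step_weight (parcs D) f) w)"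
    by (rule sum.swap)
  also have "\<dots> = (\<Sum>f\<in>?F. \<Sum>\<sigma> | \<sigma> permutes ?V.
      if \<sigma> \<in> digraph_perms D \<and> (\<forall>x\<in>?V. f (\<sigma> x) = f x) then (-1) ^ phi D \<sigma> else 0)"
    unfolding sum_path_weight_eq_sum_cycle_weight[OF fin]
    by (intro sum.cong refl prod_cycle_weight_step_weight fin) auto
  also have "\<dots> = (\<Sum>\<sigma> | \<sigma> permutes ?V. \<Sum>f\<in>?F.
      if \<sigma> \<in> digraph_perms D \<and> (\<forall>x\<in>?V. f (\<sigma> x) = f x) then (-1) ^ phi D \<sigma> else 0)"
    by (rule sum.swap)
  also have "\<dots> = (\<Sum>\<sigma>\<in>digraph_perms D. \<Sum>f\<in>?F.
      if \<forall>x\<in>?V. f (\<sigma> x) = f x then (-1) ^ phi D \<sigma> else 0)"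
    by (rule sum.mono_neutral_cong_right) (use perms fin in \<open>auto simp: finite_permutations\<close>)
  also have "\<dots> = (\<Sum>\<sigma>\<in>digraph_perms D. (-1) ^ phi D \<sigma> * mcoeff (power_sum_partition (perm_type ?V \<sigma>)) M)"
  proof (rule sum.cong[OF refl])
    fix \<sigma> assume "\<sigma> \<in> digraph_perms D"
    then have "\<sigma> permutes ?V" using perms by blast
    \<comment> \<open>The sign does not depend on \<open>f\<close>, and the colourings in
      \<open>?F\<close> invariant under \<open>\<sigma>\<close> are those counted by the coefficient
      of the power sum product.\<close>
    then show "(\<Sum>f\<in>?F. if \<forall>x\<in>?V. f (\<sigma> x) = f x then (-1) ^ phi D \<sigma> else 0) =
        (-1) ^ phi D \<sigma> * mcoeff (power_sum_partition (perm_type ?V \<sigma>)) M"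
      using finF by (simp add: mcoeff_power_sum_partition_perm_type[OF fin] sum.If_cases Int_def conj_assoc)
  qed
  also have "\<dots> = mcoeff (\<Sum>\<sigma>\<in>digraph_perms D. (-1) ^ phi D \<sigma> * power_sum_partition (perm_type ?V \<sigma>)) M"
    by (simp add: mcoeff_sum mcoeff_neg_one_power_mult)
  finally show "mcoeff (redei_berge D) M =
      mcoeff (\<Sum>\<sigma>\<in>digraph_perms D. (-1) ^ phi D \<sigma> * power_sum_partition (perm_type ?V \<sigma>)) M" .
qed

end
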